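(* For a set $X$ of real numbers, the following are equivalent: (1) $X$ satisfies $\binom{\mathcal{B}_\Omega}{\mathcal{B}_\mathrm{T}}$; (2) for each Borel image $Y$ of $X$ in $[\mathbb{N}]^\infty$, if $Y$ is centered, then there exists a large restriction of $Y$ which is linearly quasiordered by $\subseteq^*$.
   Context: All spaces $X$ are infinite sets of reals; all covers considered are assumed not to contain $X$ as a member. A cover is an $\omega$-cover of $X$ if every finite subset of $X$ lies in some member; large if each point lies in infinitely many members. A large cover $\mathcal{U}$ is a $\tau$-cover if for all $x,y\in X$, either ($x\in U\Rightarrow y\in U$) for all but finitely many $U\in\mathcal{U}$, or ($y\in U\Rightarrow x\in U$) for all but finitely many $U\in\mathcal{U}$. $\mathcal{B}_\Omega,\mathcal{B}_\mathrm{T}$ are the collections of countable Borel $\omega$-, $\tau$-covers; $X$ satisfies $\binom{\mathcal{B}_\Omega}{\mathcal{B}_\mathrm{T}}$ if every member of $\mathcal{B}_\Omega$ has a subcollection belonging to $\mathcal{B}_\mathrm{T}$. $[\mathbb{N}]^\infty$ is the space of infinite subsets of $\mathbb{N}$; $a\subseteq^*b$ means $a\setminus b$ is finite. $Y\subseteq[\mathbb{N}]^\infty$ is centered if every nonempty finite subfamily has infinite intersection. For $Y\subseteq[\mathbb{N}]^\infty$ and $a\in[\mathbb{N}]^\infty$, $Y\restriction a=\{y\cap a:y\in Y\}$; it is a large restriction if all its members are infinite. A Borel image of $X$ in $Z$ is $f[X]$ for a Borel $f:X\to Z$. *)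

theory Defs
  imports "HOL-Analysis.Analysis"
begin

definition is_cover :: "real set \<Rightarrow> real set set \<Rightarrow> bool" where
  "is_cover X \<U> \<longleftrightarrow> \<Union>\<U> = X \<and> X \<notin> \<U>"

definition omega_cover :: "real set \<Rightarrow> real set set \<Rightarrow> bool" where
  "omega_cover X \<U> \<longleftrightarrow> is_cover X \<U> \<and> (\<forall>F. finite F \<and> F \<subseteq> X \<longrightarrow> (\<exists>U\<in>\<U>. F \<subseteq> U))"

definition large_cover :: "real set \<Rightarrow> real set set \<Rightarrow> bool" where
  "large_cover X \<U> \<longleftrightarrow> is_cover X \<U> \<and> (\<forall>x\<in>X. infinite {U \<in> \<U>. x \<in> U})"

definition tau_cover :: "real set \<Rightarrow> real set set \<Rightarrow> bool" where
  "tau_cover X \<U> \<longleftrightarrow> large_cover X \<U> \<and>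
     (\<forall>x\<in>X. \<forall>y\<in>X. finite {U \<in> \<U>. \<not> (x \<in> U \<longrightarrow> y \<in> U)} \<or>
                   finite {U \<in> \<U>. \<not> (y \<in> U \<longrightarrow> x \<in> U)})"

text \<open>Members of a Borel cover of \<open>X\<close> are relatively Borel subsets of \<open>X\<close>;
  \<open>X\<close> itself need not be Borel in the reals.\<close>

definition countable_Borel_family :: "real set \<Rightarrow> real set set \<Rightarrow> bool" where
  "countable_Borel_family X \<U> \<longleftrightarrow> countable \<U> \<and> \<U> \<subseteq> sets (restrict_space borel X)"

definition B_Omega :: "real set \<Rightarrow> real set set set" where
  "B_Omega X = {\<U>. countable_Borel_family X \<U> \<and> omega_cover X \<U>}"

definition B_Tau :: "real set \<Rightarrow> real set set set" where
  "B_Tau X = {\<U>. countable_Borel_family X \<U> \<and> tau_cover X \<U>}"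

definition subcover_property :: "'a set set \<Rightarrow> 'a set set \<Rightarrow> bool" where
  "subcover_property \<AA> \<BB> \<longleftrightarrow> (\<forall>\<U>\<in>\<AA>. \<exists>\<V>. \<V> \<subseteq> \<U> \<and> \<V> \<in> \<BB>)"

definition infinite_sets :: "nat set set" where
  "infinite_sets = {a. infinite a}"

text \<open>The infinite sets of naturals carry the subspace topology from the Cantor space
  \<open>nat \<Rightarrow> bool\<close> via characteristic functions. The Borel sets of a subspace are the traces
  of the Borel sets, so the Borel \<open>\<sigma>\<close>-algebra is the one pulled back from the Cantor space.\<close>

definition borel_infinite_sets :: "nat set measure" where
  "borel_infinite_sets = vimage_algebra infinite_sets (\<lambda>a n. n \<in> a) (borel :: (nat \<Rightarrow> bool) measure)"

definition Borel_image :: "real set \<Rightarrow> nat set set \<Rightarrow> bool" where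
  "Borel_image X Y \<longleftrightarrow>
     (\<exists>f \<in> measurable (restrict_space borel X) borel_infinite_sets. Y = f ` X)"

definition centered :: "nat set set \<Rightarrow> bool" where
  "centered Y \<longleftrightarrow> (\<forall>F. finite F \<and> F \<noteq> {} \<and> F \<subseteq> Y \<longrightarrow> infinite (\<Inter>F))"

definition almost_subset :: "nat set \<Rightarrow> nat set \<Rightarrow> bool" (infix "\<subseteq>\<^sup>*" 50) where
  "a \<subseteq>\<^sup>* b \<longleftrightarrow> finite (a - b)"

definition restriction :: "nat set set \<Rightarrow> nat set \<Rightarrow> nat set set" where
  "restriction Y a = (\<lambda>y. y \<inter> a) ` Y"

definition linearly_quasiordered_by :: "'a set \<Rightarrow> ('a \<Rightarrow> 'a \<Rightarrow> bool) \<Rightarrow> bool" where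
  "linearly_quasiordered_by A R \<longleftrightarrow> reflp_on A R \<and> transp_on A R \<and> totalp_on A R"

end

theory Submission
  imports Defs
begin

text \<open>A sequence of subsets \<open>U n\<close> of \<open>X\<close> and a map \<open>f\<close> from \<open>X\<close> to the sets of naturals determine
  each other by \<open>n \<in> f x \<longleftrightarrow> x \<in> U n\<close>. Finite sets being contained in infinitely many \<open>U n\<close> means
  that the image of \<open>f\<close> is centered, and passing to a subfamily of the \<open>U n\<close> amounts to restricting
  \<open>f\<close> to a set of indices. Two degeneracies need care when starting from \<open>f\<close>: if infinitely many
  \<open>U n\<close> equal \<open>X\<close>, the set of these indices is already the required restriction, and repetitions
  among the \<open>U n\<close> are removed by choosing one index for each member of the \<open>\<tau>\<close>-cover.\<close>

text \<open>Second countability of the factor makes a map into the Cantor space Borel as soon as all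
  its coordinates are Borel.\<close>

instance bool :: second_countable_topology
proof
  show "\<exists>B::bool set set. countable B \<and> open = generate_topology B"
    by (intro exI[of _ "range lessThan \<union> range greaterThan"]) (auto simp: open_bool_def)
qed

lemma pred_measurable_borel_iff:
  fixes P :: "'a \<Rightarrow> bool"
  shows "P \<in> borel_measurable M \<longleftrightarrow> {x \<in> space M. P x} \<in> sets M"
proof -
  have "sets (borel :: bool measure) = sets (count_space UNIV)"
    by (rule sets_borel_eq_count_space)
  then have "P \<in> borel_measurable M \<longleftrightarrow> Measurable.pred M P"
    using measurable_cong_sets[OF refl, of borel "count_space UNIV" M] by blast
  then show ?thesis by (simp add: pred_def)
qed

text \<open>Translates Borel maps into sequences of Borel sets. Both directions pass through the
  characteristic function of \<open>f x\<close>, whose measurability into the Cantor space is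
  coordinatewise.\<close>

lemma measurable_borel_infinite_sets_iff:
  "f \<in> measurable M borel_infinite_sets \<longleftrightarrow>
     (\<forall>x\<in>space M. infinite (f x)) \<and> (\<forall>n. {x \<in> space M. n \<in> f x} \<in> sets M)"
proof (intro iffI conjI ballI allI)
  assume f: "f \<in> measurable M borel_infinite_sets"
  show "infinite (f x)" if "x \<in> space M" for x
    using measurable_space[OF f that] by (simp add: borel_infinite_sets_def infinite_sets_def)
  have g: "(\<lambda>a n. n \<in> a) \<in> borel_infinite_sets \<rightarrow>\<^sub>M (borel :: (nat \<Rightarrow> bool) measure)"
    unfolding borel_infinite_sets_def by (rule measurable_vimage_algebra1) simp
  have h: "(\<lambda>x n. n \<in> f x) \<in> M \<rightarrow>\<^sub>M (borel :: (nat \<Rightarrow> bool) measure)"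
    using measurable_compose[OF f g] .
  show "{x \<in> space M. n \<in> f x} \<in> sets M" for n
    using measurable_product_then_coordinatewise[OF h, of n]
    by (simp add: pred_measurable_borel_iff)
next
  assume *: "(\<forall>x\<in>space M. infinite (f x)) \<and> (\<forall>n. {x \<in> space M. n \<in> f x} \<in> sets M)"
  then have "(\<lambda>x. n \<in> f x) \<in> borel_measurable M" for n
    by (simp add: pred_measurable_borel_iff)
  then have "(\<lambda>x n. n \<in> f x) \<in> M \<rightarrow>\<^sub>M (borel :: (nat \<Rightarrow> bool) measure)"
    by (rule measurable_coordinatewise_then_product)
  then show "f \<in> measurable M borel_infinite_sets"
    unfolding borel_infinite_sets_def
    by (intro measurable_vimage_algebra2) (use * in \<open>auto simp: infinite_sets_def\<close>)
qed

lemma space_restrict_borel [simp]: "space (restrict_space borel X) = X"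
  by (simp add: space_restrict_space)

text \<open>Almost inclusion is a quasiorder on every family, so only comparability is at
  stake.\<close>

lemma linearly_quasiordered_almost_subset_iff:
  "linearly_quasiordered_by A (\<subseteq>\<^sup>*) \<longleftrightarrow> (\<forall>a\<in>A. \<forall>b\<in>A. a \<subseteq>\<^sup>* b \<or> b \<subseteq>\<^sup>* a)"
proof -
  have "transp_on A (\<subseteq>\<^sup>*)"
  proof (rule transp_onI)
    fix a b c :: "nat set"
    assume "a \<subseteq>\<^sup>* b" "b \<subseteq>\<^sup>* c"
    then have "finite ((a - b) \<union> (b - c))" by (simp add: almost_subset_def)
    then show "a \<subseteq>\<^sup>* c" unfolding almost_subset_def by (rule rev_finite_subset) auto
  qed
  then show ?thesis
    by (auto simp: linearly_quasiordered_by_def reflp_on_def totalp_on_def almost_subset_def)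
       (metis Diff_cancel finite.emptyI)
qed

text \<open>No member is all of \<open>X\<close>, so each misses some point. If only finitely many
  members contained \<open>F\<close>, adding to \<open>F\<close> a missed point of each would give a
  finite set contained in no member.\<close>

lemma omega_cover_infinite_members:
  assumes U: "omega_cover X \<U>" and F: "finite F" "F \<subseteq> X"
  shows "infinite {U \<in> \<U>. F \<subseteq> U}"
proof
  assume fin: "finite {U \<in> \<U>. F \<subseteq> U}"
  have "\<Union>\<U> = X" "X \<notin> \<U>" using U by (auto simp: omega_cover_def is_cover_def)
  then have "V \<subset> X" if "V \<in> \<U>" for V
    using that by (metis Union_upper psubsetI)
  then have "\<forall>V\<in>\<U>. \<exists>x. x \<in> X - V" by (blast dest: psubset_imp_ex_mem)
  from bchoice[OF this] obtain p where p: "p V \<in> X - V" if "V \<in> \<U>" for V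
    by auto
  let ?G = "F \<union> p ` {U \<in> \<U>. F \<subseteq> U}"
  have "finite ?G" "?G \<subseteq> X" using fin F p by auto
  then obtain V where V: "V \<in> \<U>" "?G \<subseteq> V"
    using U unfolding omega_cover_def by meson
  then have "p V \<in> V" by auto
  then show False using p[OF V(1)] by simp
qed

text \<open>By injectivity, finiteness can be tested on indices instead of members. The indices in
  \<open>a\<close> of members containing \<open>x\<close> form \<open>f x \<inter> a\<close>, so
  largeness says that these traces are infinite, and the \<open>\<tau>\<close> condition says that
  any two are comparable modulo finite sets.\<close>

lemma tau_cover_image_iff:
  assumes inj: "inj_on U a" and sub: "\<And>n. n \<in> a \<Longrightarrow> U n \<subset> X"
    and f: "\<And>x n. x \<in> X \<Longrightarrow> n \<in> a \<Longrightarrow> n \<in> f x \<longleftrightarrow> x \<in> U n"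
  shows "tau_cover X (U ` a) \<longleftrightarrow> restriction (f ` X) a \<subseteq> infinite_sets \<and>
           linearly_quasiordered_by (restriction (f ` X) a) (\<subseteq>\<^sup>*)"
proof -
  have fin: "finite {V \<in> U ` a. P V} \<longleftrightarrow> finite {n \<in> a. P (U n)}" for P
  proof -
    have "{V \<in> U ` a. P V} = U ` {n \<in> a. P (U n)}" by auto
    then show ?thesis using inj by (simp add: finite_image_iff inj_on_subset)
  qed
  have mem: "{n \<in> a. x \<in> U n} = f x \<inter> a" if "x \<in> X" for x
    using f that by auto
  have diff: "{n \<in> a. \<not> (x \<in> U n \<longrightarrow> y \<in> U n)} = f x \<inter> a - f y \<inter> a" if "x \<in> X" "y \<in> X" for x y
    using f that by auto
  have cover: "is_cover X (U ` a)" if "\<forall>x\<in>X. infinite (f x \<inter> a)"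
  proof -
    have "\<exists>n\<in>a. x \<in> U n" if "x \<in> X" for x
      using \<open>\<forall>x\<in>X. infinite (f x \<inter> a)\<close> that f
      by (metis Int_iff finite.emptyI ex_in_conv)
    then show ?thesis using sub unfolding is_cover_def by blast
  qed
  have large: "large_cover X (U ` a) \<longleftrightarrow> (\<forall>x\<in>X. infinite (f x \<inter> a))"
    unfolding large_cover_def fin using cover mem by auto
  have "restriction (f ` X) a \<subseteq> infinite_sets \<longleftrightarrow> (\<forall>x\<in>X. infinite (f x \<inter> a))"
    by (auto simp: restriction_def infinite_sets_def)
  moreover have "linearly_quasiordered_by (restriction (f ` X) a) (\<subseteq>\<^sup>*) \<longleftrightarrow>
      (\<forall>x\<in>X. \<forall>y\<in>X. f x \<inter> a \<subseteq>\<^sup>* f y \<inter> a \<or> f y \<inter> a \<subseteq>\<^sup>* f x \<inter> a)"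
    by (simp add: linearly_quasiordered_almost_subset_iff restriction_def)
  ultimately show ?thesis
    unfolding tau_cover_def large fin almost_subset_def by (simp only: diff cong: ball_cong)
qed

lemma large_restriction_if_subcover_property:
  assumes X: "infinite X" and subcover: "subcover_property (B_Omega X) (B_Tau X)"
    and f: "f \<in> measurable (restrict_space borel X) borel_infinite_sets"
    and centered: "centered (f ` X)"
  shows "\<exists>a\<in>infinite_sets. restriction (f ` X) a \<subseteq> infinite_sets \<and>
           linearly_quasiordered_by (restriction (f ` X) a) (\<subseteq>\<^sup>*)"
proof -
  define U where "U n = {x \<in> X. n \<in> f x}" for n
  have U_sets: "U n \<in> sets (restrict_space borel X)" for n
    using f by (simp add: measurable_borel_infinite_sets_iff U_def)
  define E where "E = {n. U n = X}"
  show ?thesis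
  proof (cases "finite E")
    case False
    \<comment> \<open>Every \<open>f x\<close> contains \<open>E\<close>, so the restriction to
      \<open>E\<close> has no member other than \<open>E\<close>.\<close>
    have "f x \<inter> E = E" if "x \<in> X" for x
      using that by (auto simp: E_def U_def)
    then have "b = E" if "b \<in> restriction (f ` X) E" for b
      using that by (auto simp: restriction_def)
    moreover from this
    have "linearly_quasiordered_by (restriction (f ` X) E) (\<subseteq>\<^sup>*)"
      unfolding linearly_quasiordered_almost_subset_iff almost_subset_def
      by (metis Diff_cancel finite.emptyI)
    ultimately show ?thesis using False unfolding infinite_sets_def by blast
  next
    case True
    have finite_in_member: "\<exists>V\<in>U ` (- E). F \<subseteq> V" if F: "finite F" "F \<subseteq> X" for F
    proof -
      \<comment> \<open>The extra point \<open>z\<close> covers the case of empty \<open>F\<close>,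
        since centeredness speaks of nonempty families only.\<close>
      obtain z where z: "z \<in> X" using X by (metis ex_in_conv finite.emptyI)
      have "infinite (\<Inter> (f ` insert z F))"
        using centered F z unfolding centered_def
        by (metis finite_imageI finite_insert image_is_empty image_mono insert_not_empty insert_subset)
      \<comment> \<open>An infinite intersection cannot lie inside the finite set
        \<open>E\<close>.\<close>
      then obtain n where "n \<in> \<Inter> (f ` insert z F)" "n \<notin> E"
        using True by (meson finite_subset subsetI)
      then show ?thesis using F by (auto simp: U_def)
    qed
    have "\<Union> (U ` (- E)) = X"
    proof
      show "X \<subseteq> \<Union> (U ` (- E))"
        using finite_in_member[of "{x}" for x] by blast
    qed (auto simp: U_def)
    then have "U ` (- E) \<in> B_Omega X"
      using U_sets finite_in_member
      by (auto simp: B_Omega_def countable_Borel_family_def omega_cover_def is_cover_def E_def)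
    then obtain \<V> where \<V>: "\<V> \<subseteq> U ` (- E)" "\<V> \<in> B_Tau X"
      using subcover unfolding subcover_property_def by meson
    then obtain a where a: "a \<subseteq> - E" "inj_on U a" "\<V> = U ` a"
      by (auto simp: subset_image_inj)
    have tau: "tau_cover X (U ` a)" using \<V> a by (simp add: B_Tau_def)
    \<comment> \<open>A finite family cannot cover a point infinitely often, and \<open>X\<close>
      has points.\<close>
    have "infinite a"
    proof
      assume "finite a"
      then have "X = {}" using tau by (auto simp: tau_cover_def large_cover_def)
      then show False using X by simp
    qed
    moreover have "U n \<subset> X" if "n \<in> a" for n
      using a that by (auto simp: E_def U_def)
    ultimately show ?thesis
      using tau tau_cover_image_iff[OF a(2), of X f] by (auto simp: infinite_sets_def U_def)
  qed
qed

lemma subcover_property_if_large_restrictions: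
  assumes restr: "\<And>Y. Borel_image X Y \<Longrightarrow> centered Y \<Longrightarrow>
      \<exists>a\<in>infinite_sets. restriction Y a \<subseteq> infinite_sets \<and>
        linearly_quasiordered_by (restriction Y a) (\<subseteq>\<^sup>*)"
  shows "subcover_property (B_Omega X) (B_Tau X)"
  unfolding subcover_property_def
proof
  fix \<U> assume \<U>: "\<U> \<in> B_Omega X"
  then have omega: "omega_cover X \<U>" and cover: "is_cover X \<U>" and "countable \<U>"
    and sets: "\<U> \<subseteq> sets (restrict_space borel X)"
    by (auto simp: B_Omega_def countable_Borel_family_def omega_cover_def)
  \<comment> \<open>Every member contains the empty set. Infinitude allows an enumeration by all
    naturals without repetition.\<close>
  have "infinite \<U>"
    using omega_cover_infinite_members[OF omega, of "{}"] by simp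
  then obtain U :: "nat \<Rightarrow> real set" where U: "bij_betw U UNIV \<U>"
    using \<open>countable \<U>\<close> by (metis bij_betw_from_nat_into)
  then have inj: "inj U" and range: "range U = \<U>"
    by (auto simp: bij_betw_def)
  define f where "f x = {n. x \<in> U n}" for x
  \<comment> \<open>Used twice: singletons show that the values of \<open>f\<close> are infinite,
    and general finite sets show that its image is centered.\<close>
  have inter: "infinite {n. F \<subseteq> U n}" if "finite F" "F \<subseteq> X" for F
  proof
    assume "finite {n. F \<subseteq> U n}"
    then have "finite (U ` {n. F \<subseteq> U n})" by simp
    moreover have "U ` {n. F \<subseteq> U n} = {V \<in> \<U>. F \<subseteq> V}" using range by auto
    ultimately show False using omega_cover_infinite_members[OF omega that] by simp
  qed
  \<comment> \<open>Members of the cover lie inside \<open>X\<close>, so the coordinate sets of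
    \<open>f\<close> are the given Borel sets themselves.\<close>
  have "{x \<in> X. n \<in> f x} = U n" for n
    using cover range by (auto simp: f_def is_cover_def)
  then have "f \<in> measurable (restrict_space borel X) borel_infinite_sets"
    using inter[of "{x}" for x] sets range
    by (auto simp: measurable_borel_infinite_sets_iff f_def)
  moreover have "centered (f ` X)"
    unfolding centered_def
  proof (intro allI impI, elim conjE)
    fix G assume "finite G" "G \<subseteq> f ` X"
    then obtain F where F: "finite F" "F \<subseteq> X" "G = f ` F"
      by (meson finite_subset_image)
    have "\<Inter> G = {n. F \<subseteq> U n}" unfolding F by (auto simp: f_def)
    then show "infinite (\<Inter> G)" using inter F by simp
  qed
  ultimately obtain a where a: "restriction (f ` X) a \<subseteq> infinite_sets"
      "linearly_quasiordered_by (restriction (f ` X) a) (\<subseteq>\<^sup>*)"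
    using restr[of "f ` X"] unfolding Borel_image_def by blast
  have "U n \<subset> X" for n
    using cover range unfolding is_cover_def by blast
  then have "tau_cover X (U ` a)"
    using a tau_cover_image_iff[OF inj_on_subset[OF inj], of a X f] by (simp add: f_def)
  moreover have "U ` a \<subseteq> \<U>" using range by auto
  ultimately show "\<exists>\<V>\<subseteq>\<U>. \<V> \<in> B_Tau X"
    using \<open>countable \<U>\<close> sets
    by (intro exI[of _ "U ` a"]) (auto simp: B_Tau_def countable_Borel_family_def)
qed

theorem theorem3p8:
  fixes X :: "real set"
  assumes "infinite X"
  shows "subcover_property (B_Omega X) (B_Tau X) \<longleftrightarrow>
    (\<forall>Y. Borel_image X Y \<longrightarrow> centered Y \<longrightarrow>
       (\<exists>a\<in>infinite_sets. restriction Y a \<subseteq> infinite_sets \<and>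
          linearly_quasiordered_by (restriction Y a) (\<subseteq>\<^sup>*)))"
  using large_restriction_if_subcover_property[OF assms] subcover_property_if_large_restrictions[of X]
  unfolding Borel_image_def by blast

end
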